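(* Consider the RDAG model on a coloured DAG $(\mathcal{G},c)$ with compatible colouring $c$, and a sample matrix $Y\in\mathbb{R}^{m\times n}$. Stability of $Y$ under the set $A(\mathcal{G},c)_{\mathrm{SL}}$ relates to maximum likelihood estimation in the model as follows: (a) $Y$ is unstable if and only if $\ell_Y$ is unbounded from above; (b) $Y$ is semistable if and only if $\ell_Y$ is bounded from above; (c) $Y$ is polystable if and only if an MLE given $Y$ exists; (d) $Y$ is stable if and only if an MLE given $Y$ exists and is unique.
   Context: $\mathcal{G}=(I,E)$ is a directed acyclic graph (DAG) with vertex set $I=[m]=\{1,\dots,m\}$ and edge set $E$ (no loops, no multiple edges); $j\to i$ denotes an edge from $j$ to $i$. Vertices are ordered so that $j\to i$ implies $j>i$. A coloured DAG $(\mathcal{G},c)$ is a DAG with a map $c: I\cup E\to \mathcal{C}$ to a set of colours; $c(i)$ (also written $c(ii)$) is the colour of vertex $i$ and $c(ij)$ is the colour of the edge $j\to i$. The colouring $c$ is compatible if (i) vertex colours and edge colours are disjoint, and (ii) whenever edges $j\to i$ and $l\to k$ satisfy $c(ij)=c(kl)$, then $c(i)=c(k)$. The RDAG model on $(\mathcal{G},c)$ is the set of all matrices $\Psi=(\mathrm{id}-\Lambda)^{\mathsf T}\Omega^{-1}(\mathrm{id}-\Lambda)$, where $\Lambda\in\mathbb{R}^{m\times m}$ satisfies $\lambda_{ij}=0$ unless $j\to i$ in $\mathcal{G}$ and $\lambda_{ij}=\lambda_{kl}$ whenever edges $j\to i$ and $l\to k$ have the same colour, and $\Omega\in\mathbb{R}^{m\times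 m}$ is diagonal with positive diagonal entries satisfying $\omega_{ii}=\omega_{jj}$ whenever vertices $i,j$ have the same colour. $A(\mathcal{G},c)$ is the set of real invertible $m\times m$ matrices $a$ with $a_{ij}=0$ for $i\ne j$ with $j\not\to i$ in $\mathcal{G}$, and $a_{ij}=a_{kl}$ whenever $c(ij)=c(kl)$ (for vertices and edges). $A(\mathcal{G},c)_{\mathrm{SL}}=\{a\in A(\mathcal{G},c)\mid\det(a)=1\}$. For $Y\in\mathbb{R}^{m\times n}$ ($n\ge1$), the log-likelihood is $\ell_Y(\Psi)=\log\det(\Psi)-\mathrm{tr}(\Psi S_Y)$ with $S_Y=\frac1n YY^{\mathsf T}$; boundedness refers to $\ell_Y$ on the model, and an MLE given $Y$ is a maximiser of $\ell_Y$ over the model. For a set $A$ of real invertible $m\times m$ matrices and $Y\in\mathbb{R}^{m\times n}$, put $A\cdot Y=\{aY\mid a\in A\}$ and $A_Y=\{a\in A\mid aY=Y\}$. Under $A$, the matrix $Y$ is: unstable if $0\in\overline{A\cdot Y}$ (Euclidean closure); semistable if it is not unstable; polystable if $Y\neq0$ and $A\cdot Y$ is Euclidean closed; stable if $Y$ is polystable and $A_Y$ is finite. *)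

theory Defs
  imports "HOL-Analysis.Analysis"
begin

text \<open>
  The vertex set is a finite well-ordered type, i.e. a copy of \<open>{1, \<dots>, m}\<close> with its order.
  A pair \<open>(j, i) \<in> E\<close> is the edge from \<open>j\<close> to \<open>i\<close>. A colouring is a function \<open>c\<close> where
  \<open>c i i\<close> is the colour of the vertex \<open>i\<close> and, for \<open>(j, i) \<in> E\<close>, \<open>c i j\<close> is the colour of
  the edge from \<open>j\<close> to \<open>i\<close> (indices in the order of matrix entries); the other values
  of \<open>c\<close> are never used.
\<close>

definition ordered_dag :: "('m::{finite,wellorder} \<times> 'm) set \<Rightarrow> bool" where
  "ordered_dag E \<longleftrightarrow> acyclic E \<and> (\<forall>i j. (j, i) \<in> E \<longrightarrow> j > i)"

definition compatible_colouring :: "('m \<times> 'm) set \<Rightarrow> ('m \<Rightarrow> 'm \<Rightarrow> 'c) \<Rightarrow> bool" where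
  "compatible_colouring E c \<longleftrightarrow>
     (\<forall>v i j. (j, i) \<in> E \<longrightarrow> c v v \<noteq> c i j) \<and>
     (\<forall>i j k l. (j, i) \<in> E \<longrightarrow> (l, k) \<in> E \<longrightarrow> c i j = c k l \<longrightarrow> c i i = c k k)"

definition rdag_model ::
    "('m::finite \<times> 'm) set \<Rightarrow> ('m \<Rightarrow> 'm \<Rightarrow> 'c) \<Rightarrow> (real^'m^'m) set" where
  "rdag_model E c =
     {transpose (mat 1 - \<Lambda>) ** matrix_inv \<Omega> ** (mat 1 - \<Lambda>) | \<Lambda> \<Omega>.
        (\<forall>i j. (j, i) \<notin> E \<longrightarrow> \<Lambda> $ i $ j = 0) \<and>
        (\<forall>i j k l. (j, i) \<in> E \<longrightarrow> (l, k) \<in> E \<longrightarrow> c i j = c k l \<longrightarrow> \<Lambda> $ i $ j = \<Lambda> $ k $ l) \<and>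
        (\<forall>i j. i \<noteq> j \<longrightarrow> \<Omega> $ i $ j = 0) \<and>
        (\<forall>i. \<Omega> $ i $ i > 0) \<and>
        (\<forall>i j. c i i = c j j \<longrightarrow> \<Omega> $ i $ i = \<Omega> $ j $ j)}"

definition coloured_matrices ::
    "('m::finite \<times> 'm) set \<Rightarrow> ('m \<Rightarrow> 'm \<Rightarrow> 'c) \<Rightarrow> (real^'m^'m) set" where
  "coloured_matrices E c =
     {a. invertible a \<and>
         (\<forall>i j. i \<noteq> j \<longrightarrow> (j, i) \<notin> E \<longrightarrow> a $ i $ j = 0) \<and>
         (\<forall>i j k l. (i = j \<or> (j, i) \<in> E) \<longrightarrow> (k = l \<or> (l, k) \<in> E) \<longrightarrow>
            c i j = c k l \<longrightarrow> a $ i $ j = a $ k $ l)}"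

definition coloured_matrices_SL ::
    "('m::finite \<times> 'm) set \<Rightarrow> ('m \<Rightarrow> 'm \<Rightarrow> 'c) \<Rightarrow> (real^'m^'m) set" where
  "coloured_matrices_SL E c = {a \<in> coloured_matrices E c. det a = 1}"

definition sample_cov :: "real^'n^'m \<Rightarrow> real^'m^'m" where
  "sample_cov Y = (1 / real CARD('n)) *\<^sub>R (Y ** transpose Y)"

definition log_likelihood :: "real^'n^'m \<Rightarrow> real^'m^'m \<Rightarrow> real" where
  "log_likelihood Y \<Psi> = ln (det \<Psi>) - trace (\<Psi> ** sample_cov Y)"

definition is_MLE :: "(real^'m^'m) set \<Rightarrow> real^'n^'m \<Rightarrow> real^'m^'m \<Rightarrow> bool" where
  "is_MLE M Y \<Psi> \<longleftrightarrow> \<Psi> \<in> M \<and> (\<forall>\<Phi>\<in>M. log_likelihood Y \<Phi> \<le> log_likelihood Y \<Psi>)"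

definition orbit_of :: "(real^'m^'m) set \<Rightarrow> real^'n^'m \<Rightarrow> (real^'n^'m) set" where
  "orbit_of A Y = (\<lambda>a. a ** Y) ` A"

definition stabilizer_of :: "(real^'m^'m) set \<Rightarrow> real^'n^'m \<Rightarrow> (real^'m^'m) set" where
  "stabilizer_of A Y = {a \<in> A. a ** Y = Y}"

definition unstable_under :: "(real^'m^'m) set \<Rightarrow> real^'n^'m \<Rightarrow> bool" where
  "unstable_under A Y \<longleftrightarrow> 0 \<in> closure (orbit_of A Y)"

definition semistable_under :: "(real^'m^'m) set \<Rightarrow> real^'n^'m \<Rightarrow> bool" where
  "semistable_under A Y \<longleftrightarrow> \<not> unstable_under A Y"

definition polystable_under :: "(real^'m^'m) set \<Rightarrow> real^'n^'m \<Rightarrow> bool" where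
  "polystable_under A Y \<longleftrightarrow> Y \<noteq> 0 \<and> closed (orbit_of A Y)"

definition stable_under :: "(real^'m^'m) set \<Rightarrow> real^'n^'m \<Rightarrow> bool" where
  "stable_under A Y \<longleftrightarrow> polystable_under A Y \<and> finite (stabilizer_of A Y)"

end

theory Submission
  imports Defs
begin

text \<open>
  Let \<open>L\<close> be the linear space of coloured edge-weight matrices \<open>\<Lambda>\<close> and \<open>V\<close> the space of
  vectors that are constant on vertex colours. By compatibility of the colouring, scaling the
  rows of an element of \<open>L\<close> by an element of \<open>V\<close> gives an element of \<open>L\<close>. Hence the elements
  of \<open>A(G,c)\<^sub>S\<^sub>L\<close> are exactly the matrices \<open>diag d ** (1 - \<Lambda>)\<close> with \<open>d \<in> V\<close> of product \<open>1\<close> and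
  \<open>\<Lambda> \<in> L\<close> (\<open>SL_iff\<close>), while the model consists of the matrices
  \<open>(1 - \<Lambda>)\<^sup>T diag (1/\<omega>) (1 - \<Lambda>)\<close> with \<open>\<Lambda> \<in> L\<close> and positive \<open>\<omega> \<in> V\<close>. Both sides of the
  theorem therefore only see the residuals \<open>Y - \<Lambda> Y\<close>, rescaled by one factor per vertex
  colour. The dividing line is whether \<open>Y\<close> is degenerate: some \<open>\<Lambda> \<in> L\<close> makes the residual
  vanish on all vertices of one colour.

  If \<open>Y\<close> is degenerate, the variance of that colour can be sent to \<open>0\<close>, so the log-likelihood is
  unbounded, and the rows of the other colours can be shrunk to \<open>0\<close> at determinant \<open>1\<close>, so
  \<open>0\<close> lies in the orbit closure. The orbit cannot then be closed unless \<open>Y = 0\<close>.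

  If \<open>Y\<close> is not degenerate, take the point of \<open>{\<Lambda> Y | \<Lambda> \<in> L}\<close> closest to \<open>Y\<close>. Since rows of
  different colours can be chosen independently, it minimises the residual of every colour
  simultaneously (\<open>least_squares_colourwise\<close>), and all these minima are positive. On the
  orbit side they bound the factors \<open>d\<close> along a convergent sequence, and compactness shows
  that the orbit is closed (\<open>closed_orbit\<close>). On the likelihood side, for each colour one
  minimises \<open>ln \<omega> + p / \<omega>\<close>, which is an elementary inequality whose equality case is known
  (\<open>least_squares_maximises\<close>); so an MLE exists.

  Finally, in the nondegenerate case, both finiteness of the stabiliser and uniqueness of the
  MLE are equivalent to the implication \<open>N Y = 0 \<Longrightarrow> N = 0\<close> on \<open>L\<close>
  (\<open>finite_stabilizer_iff\<close>, \<open>MLE_unique_iff\<close>).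
\<close>

section \<open>Diagonal matrices and matrix identities\<close>

text \<open>The diagonal matrix with diagonal \<open>d\<close>.\<close>

definition vdiag :: "real^'m \<Rightarrow> real^'m^'m::finite" where
  "vdiag d = (\<chi> i j. if i = j then d $ i else 0)"

lemma vdiag_mult_row: "(vdiag d ** M) $ i = d $ i *\<^sub>R M $ i"
  for M :: "real^'n^'m::finite"
proof -
  have "(vdiag d ** M) $ i $ k = d $ i * M $ i $ k" for k
    by (simp add: vdiag_def matrix_matrix_mult_def if_distrib[of "\<lambda>x. x * _"] cong: if_cong)
  then show ?thesis
    by (simp add: vec_eq_iff)
qed

lemma vdiag_nth: "vdiag d $ i $ j = (if i = j then d $ i else 0)"
  by (simp add: vdiag_def)

lemma vdiag_mult_vdiag: "vdiag d ** vdiag e = vdiag (\<chi> i. d $ i * e $ i)"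
  by (simp add: vec_eq_iff vdiag_mult_row vdiag_nth)

lemma vdiag_one: "vdiag (\<chi> i. 1) = mat 1"
  by (simp add: vec_eq_iff vdiag_nth mat_def)

lemma matrix_inv_vdiag:
  assumes "\<And>i. d $ i \<noteq> 0"
  shows "matrix_inv (vdiag d) = vdiag (\<chi> i. 1 / d $ i)"
proof -
  let ?e = "vdiag (\<chi> i. 1 / d $ i)"
  have e: "vdiag d ** ?e = mat 1" "?e ** vdiag d = mat 1"
    using assms by (simp_all add: vdiag_mult_vdiag flip: vdiag_one)
  then have "vdiag d ** matrix_inv (vdiag d) = mat 1"
    unfolding matrix_inv_def by (metis (mono_tags, lifting) someI_ex)
  then have "?e ** (vdiag d ** matrix_inv (vdiag d)) = ?e"
    by simp
  then show ?thesis
    by (simp add: matrix_mul_assoc e)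
qed

lemma det_vdiag: "det (vdiag d) = (\<Prod>i\<in>UNIV. d $ i)"
  by (subst det_diagonal) (auto simp: vdiag_nth)

lemma norm_matrix_sq: "(norm M)\<^sup>2 = (\<Sum>i\<in>UNIV. (norm (M $ i))\<^sup>2)"
  for M :: "real^'n^'m"
  by (simp add: power2_norm_eq_inner inner_vec_def)

lemma matrix_mult_diff_left: "(A - B) ** C = A ** C - B ** C"
  for A B :: "real^'m^'k" and C :: "real^'n^'m"
  by (simp add: vec_eq_iff matrix_matrix_mult_def left_diff_distrib sum_subtractf)

lemma matrix_mult_diff_right: "C ** (A - B) = C ** A - C ** B"
  for A B :: "real^'m^'k" and C :: "real^'k^'n"
  by (simp add: vec_eq_iff matrix_matrix_mult_def right_diff_distrib sum_subtractf)

lemma matrix_mult_add_left: "(A + B) ** C = A ** C + B ** C"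
  for A B :: "real^'m^'k" and C :: "real^'n^'m"
  by (simp add: vec_eq_iff matrix_matrix_mult_def distrib_right sum.distrib)

lemma matrix_mult_scaleR_left: "(r *\<^sub>R A) ** C = r *\<^sub>R (A ** C)"
  for A :: "real^'m^'k" and C :: "real^'n^'m"
  by (simp add: vec_eq_iff matrix_matrix_mult_def sum_distrib_left mult.assoc)

lemma transpose_add: "transpose (A + B) = transpose A + transpose B"
  for A B :: "real^'m^'k"
  by (simp add: vec_eq_iff transpose_def)

lemma transpose_diff: "transpose (A - B) = transpose A - transpose B"
  for A B :: "real^'m^'k"
  by (simp add: vec_eq_iff transpose_def)

lemma trace_congruence_vdiag:
  fixes U :: "real^'m^'k::finite" and Y :: "real^'n^'m"
  shows "trace (transpose U ** vdiag d ** U ** (Y ** transpose Y))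
    = (\<Sum>i\<in>UNIV. d $ i * (norm ((U ** Y) $ i))\<^sup>2)"
proof -
  have "trace (transpose U ** vdiag d ** U ** (Y ** transpose Y))
      = trace (transpose U ** (vdiag d ** U ** Y ** transpose Y))"
    by (simp add: matrix_mul_assoc)
  also have "\<dots> = trace (vdiag d ** (U ** Y) ** transpose (U ** Y))"
    by (subst trace_mul_sym) (simp add: matrix_mul_assoc matrix_transpose_mul)
  also have "\<dots> = (\<Sum>i\<in>UNIV. d $ i * (norm ((U ** Y) $ i))\<^sup>2)"
    unfolding trace_def
  proof (rule sum.cong[OF refl])
    fix i
    have "(vdiag d ** (U ** Y) ** transpose (U ** Y)) $ i $ i
        = (\<Sum>k\<in>UNIV. (vdiag d ** (U ** Y)) $ i $ k * (U ** Y) $ i $ k)"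
      by (subst matrix_matrix_mult_def) (simp add: transpose_def)
    then show "(vdiag d ** (U ** Y) ** transpose (U ** Y)) $ i $ i = d $ i * (norm ((U ** Y) $ i))\<^sup>2"
      by (simp add: vdiag_mult_row power2_norm_eq_inner inner_vec_def sum_distrib_left mult.assoc)
  qed
  finally show ?thesis .
qed

lemma congruence_vdiag_eq_0:
  fixes N :: "real^'m^'k::finite"
  assumes "transpose N ** vdiag d ** N = 0" and "\<And>i. d $ i > 0"
  shows "N = 0"
proof -
  have "(\<Sum>k\<in>UNIV. d $ k * (norm (N $ k))\<^sup>2) = 0"
    using trace_congruence_vdiag[of N d "mat 1"] assms(1)
    by (simp add: transpose_mat trace_def)
  moreover have "d $ k * (norm (N $ k))\<^sup>2 \<ge> 0" for k
    by (rule mult_nonneg_nonneg[OF less_imp_le[OF assms(2)] zero_le_power2])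
  ultimately have "\<forall>k\<in>UNIV. d $ k * (norm (N $ k))\<^sup>2 = 0"
    by (simp add: sum_nonneg_eq_0_iff)
  then have "d $ k = 0 \<or> N $ k = 0" for k
    by simp
  then have "N $ k = 0" for k
    by (metis assms(2) less_irrefl)
  then show ?thesis
    by (simp add: vec_eq_iff)
qed

section \<open>Coloured parameters\<close>

text \<open>The space of edge-weight matrices supported on \<open>E\<close> and constant on edge colours.
  The entry \<open>\<Lambda> $ i $ j\<close> is the weight of the edge from \<open>j\<close> to \<open>i\<close>.\<close>

definition edge_matrices ::
    "('m::finite \<times> 'm) set \<Rightarrow> ('m \<Rightarrow> 'm \<Rightarrow> 'c) \<Rightarrow> (real^'m^'m) set" where
  "edge_matrices E c =
     {\<Lambda>. (\<forall>i j. (j, i) \<notin> E \<longrightarrow> \<Lambda> $ i $ j = 0) \<and>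
        (\<forall>i j k l. (j, i) \<in> E \<longrightarrow> (l, k) \<in> E \<longrightarrow> c i j = c k l \<longrightarrow> \<Lambda> $ i $ j = \<Lambda> $ k $ l)}"

text \<open>The space of vectors that are constant on vertex colours; it contains the noise variances
  of the model and the diagonals of the group elements.\<close>

definition vertex_vectors :: "('m \<Rightarrow> 'm \<Rightarrow> 'c) \<Rightarrow> (real^'m::finite) set" where
  "vertex_vectors c = {d. \<forall>i j. c i i = c j j \<longrightarrow> d $ i = d $ j}"

lemma edge_matricesI:
  assumes "\<And>i j. (j, i) \<notin> E \<Longrightarrow> \<Lambda> $ i $ j = 0"
    and "\<And>i j k l. (j, i) \<in> E \<Longrightarrow> (l, k) \<in> E \<Longrightarrow> c i j = c k l \<Longrightarrow> \<Lambda> $ i $ j = \<Lambda> $ k $ l"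
  shows "\<Lambda> \<in> edge_matrices E c"
  using assms unfolding edge_matrices_def by blast

lemma edge_matrices_zero: "\<Lambda> \<in> edge_matrices E c \<Longrightarrow> (j, i) \<notin> E \<Longrightarrow> \<Lambda> $ i $ j = 0"
  unfolding edge_matrices_def by blast

lemma edge_matrices_colour:
  "\<Lambda> \<in> edge_matrices E c \<Longrightarrow> (j, i) \<in> E \<Longrightarrow> (l, k) \<in> E \<Longrightarrow> c i j = c k l
    \<Longrightarrow> \<Lambda> $ i $ j = \<Lambda> $ k $ l"
  unfolding edge_matrices_def by blast

lemma vertex_vectorsI:
  "(\<And>i j. c i i = c j j \<Longrightarrow> d $ i = d $ j) \<Longrightarrow> d \<in> vertex_vectors c"
  unfolding vertex_vectors_def by blast

lemma vertex_vectorsD: "d \<in> vertex_vectors c \<Longrightarrow> c i i = c j j \<Longrightarrow> d $ i = d $ j"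
  unfolding vertex_vectors_def by blast

lemma subspace_edge_matrices: "subspace (edge_matrices E c)"
proof (rule subspaceI)
  show "0 \<in> edge_matrices E c"
    by (rule edge_matricesI) simp_all
next
  fix A B assume A: "A \<in> edge_matrices E c" and B: "B \<in> edge_matrices E c"
  show "A + B \<in> edge_matrices E c"
  proof (rule edge_matricesI)
    fix i j k l assume e: "(j, i) \<in> E" "(l, k) \<in> E" "c i j = c k l"
    show "(A + B) $ i $ j = (A + B) $ k $ l"
      using edge_matrices_colour[OF A e] edge_matrices_colour[OF B e] by simp
  qed (simp add: edge_matrices_zero[OF A] edge_matrices_zero[OF B])
next
  fix r A assume A: "A \<in> edge_matrices E c"
  show "r *\<^sub>R A \<in> edge_matrices E c"
  proof (rule edge_matricesI)
    fix i j k l assume e: "(j, i) \<in> E" "(l, k) \<in> E" "c i j = c k l"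
    show "(r *\<^sub>R A) $ i $ j = (r *\<^sub>R A) $ k $ l"
      using edge_matrices_colour[OF A e] by simp
  qed (simp add: edge_matrices_zero[OF A])
qed

text \<open>The concentration matrix of the linear structural equation model with edge weights
  \<open>\<Lambda>\<close> and noise variances \<open>\<omega>\<close>.\<close>

definition precision :: "real^'m^'m \<Rightarrow> real^'m \<Rightarrow> real^'m^'m::finite" where
  "precision \<Lambda> \<omega> = transpose (mat 1 - \<Lambda>) ** vdiag (\<chi> i. 1 / \<omega> $ i) ** (mat 1 - \<Lambda>)"

lemma rdag_model_eq:
  "rdag_model E c =
    {precision \<Lambda> \<omega> | \<Lambda> \<omega>. \<Lambda> \<in> edge_matrices E c \<and> \<omega> \<in> vertex_vectors c \<and> (\<forall>i. \<omega> $ i > 0)}"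
    (is "_ = ?R")
proof
  show "rdag_model E c \<subseteq> ?R"
  proof
    fix \<Psi> assume "\<Psi> \<in> rdag_model E c"
    then obtain \<Lambda> \<Omega> where \<Psi>: "\<Psi> = transpose (mat 1 - \<Lambda>) ** matrix_inv \<Omega> ** (mat 1 - \<Lambda>)"
      and \<Lambda>: "\<Lambda> \<in> edge_matrices E c"
      and \<Omega>: "\<forall>i j. i \<noteq> j \<longrightarrow> \<Omega> $ i $ j = 0" "\<forall>i. \<Omega> $ i $ i > 0"
        "\<forall>i j. c i i = c j j \<longrightarrow> \<Omega> $ i $ i = \<Omega> $ j $ j"
      unfolding rdag_model_def edge_matrices_def by blast
    define \<omega> where "\<omega> = (\<chi> i. \<Omega> $ i $ i)"
    have "\<Omega> = vdiag \<omega>"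
      using \<Omega>(1) by (simp add: vec_eq_iff vdiag_nth \<omega>_def)
    moreover have pos: "\<omega> $ i > 0" for i
      using \<Omega>(2) by (simp add: \<omega>_def)
    ultimately have "matrix_inv \<Omega> = vdiag (\<chi> i. 1 / \<omega> $ i)"
      by (simp add: matrix_inv_vdiag less_imp_neq[symmetric])
    then have "\<Psi> = precision \<Lambda> \<omega>"
      by (simp add: \<Psi> precision_def)
    moreover have "\<omega> \<in> vertex_vectors c"
      by (rule vertex_vectorsI, unfold \<omega>_def vec_lambda_beta) (use \<Omega>(3) in blast)
    ultimately show "\<Psi> \<in> ?R"
      using \<Lambda> pos by blast
  qed
next
  show "?R \<subseteq> rdag_model E c"
  proof clarify
    fix \<Lambda> \<omega> assume *: "\<Lambda> \<in> edge_matrices E c" "\<omega> \<in> vertex_vectors c" "\<forall>i. \<omega> $ i > 0"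
    have "matrix_inv (vdiag \<omega>) = vdiag (\<chi> i. 1 / \<omega> $ i)"
      using *(3) by (intro matrix_inv_vdiag) (metis less_irrefl)
    then have eq: "precision \<Lambda> \<omega> = transpose (mat 1 - \<Lambda>) ** matrix_inv (vdiag \<omega>) ** (mat 1 - \<Lambda>)"
      by (simp add: precision_def)
    show "precision \<Lambda> \<omega> \<in> rdag_model E c"
      unfolding rdag_model_def mem_Collect_eq
    proof (rule exI[of _ \<Lambda>], rule exI[of _ "vdiag \<omega>"], intro conjI)
      show "\<forall>i j. i \<noteq> j \<longrightarrow> vdiag \<omega> $ i $ j = 0" "\<forall>i. vdiag \<omega> $ i $ i > 0"
        using *(3) by (simp_all add: vdiag_nth)
      show "\<forall>i j. c i i = c j j \<longrightarrow> vdiag \<omega> $ i $ i = vdiag \<omega> $ j $ j"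
      proof (intro allI impI)
        fix i j assume "c i i = c j j"
        from vertex_vectorsD[OF *(2) this] show "vdiag \<omega> $ i $ i = vdiag \<omega> $ j $ j"
          by (simp add: vdiag_nth)
      qed
    qed (use eq *(1) in \<open>unfold edge_matrices_def, blast+\<close>)
  qed
qed

section \<open>Auxiliary sums and inequalities\<close>

text \<open>Replacing \<open>f\<close> by its average over each colour class does not change a sum whose weights
  depend on the colour only. This allows sums over vertices in place of sums over colours.\<close>

lemma sum_colour_average:
  fixes w f :: "'m::finite \<Rightarrow> real" and col :: "'m \<Rightarrow> 'c"
  assumes "\<And>i j. col i = col j \<Longrightarrow> w i = w j"
  shows "(\<Sum>i\<in>UNIV. w i * ((\<Sum>j | col j = col i. f j) / real (card {j. col j = col i})))
    = (\<Sum>i\<in>UNIV. w i * f i)"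
proof -
  have "(\<Sum>i\<in>UNIV. w i * ((\<Sum>j | col j = col i. f j) / real (card {j. col j = col i})))
      = (\<Sum>i\<in>UNIV. \<Sum>j | col j = col i. w j * f j / real (card {k. col k = col j}))"
    unfolding sum_divide_distrib sum_distrib_left
  proof (intro sum.cong refl)
    fix i j assume "j \<in> {j. col j = col i}"
    then have "col j = col i"
      by simp
    with assms[OF this] show "w i * (f j / real (card {j. col j = col i}))
        = w j * f j / real (card {k. col k = col j})"
      by simp
  qed
  also have "\<dots> = (\<Sum>j\<in>UNIV. \<Sum>i | col j = col i. w j * f j / real (card {k. col k = col j}))"
    using sum.swap_restrict[of UNIV UNIV "\<lambda>i j. w j * f j / real (card {k. col k = col j})" "\<lambda>i j. col j = col i"]
    by simp
  also have "\<dots> = (\<Sum>j\<in>UNIV. w j * f j)"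
  proof (rule sum.cong[OF refl])
    fix j
    have "{i. col j = col i} = {k. col k = col j}" "{k. col k = col j} \<noteq> {}"
      by auto
    then show "(\<Sum>i | col j = col i. w j * f j / real (card {k. col k = col j})) = w j * f j"
      by simp
  qed
  finally show ?thesis .
qed

text \<open>For fixed \<open>p\<close>, \<open>ln w + p / w\<close> is minimal exactly at \<open>w = p\<close>, with value \<open>ln p + 1\<close>; here this is
  combined with monotonicity in \<open>p\<close>.\<close>

lemma ln_add_divide_ge:
  fixes q p w :: real
  assumes "0 < q" "q \<le> p" "0 < w"
  shows "ln q + 1 \<le> ln w + p / w"
proof -
  have "ln (q / w) \<le> q / w - 1"
    using assms by (intro ln_le_minus_one) simp
  moreover have "q / w \<le> p / w"
    using assms by (simp add: divide_right_mono)
  ultimately show ?thesis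
    using assms by (simp add: ln_div)
qed

lemma ln_add_divide_eq:
  fixes q p w :: real
  assumes "0 < q" "q \<le> p" "0 < w" and eq: "ln q + 1 = ln w + p / w"
  shows "w = q" "p = q"
proof -
  have "ln (q / w) \<le> q / w - 1"
    using assms by (intro ln_le_minus_one) simp
  moreover have "q / w \<le> p / w"
    using assms by (simp add: divide_right_mono)
  moreover have "ln (q / w) = p / w - 1"
    using assms by (simp add: ln_div)
  ultimately have "ln (q / w) = q / w - 1" "p / w = q / w"
    by linarith+
  then have "q / w = 1"
    using assms by (intro ln_eq_minus_one) simp_all
  then show "w = q" "p = q"
    using \<open>p / w = q / w\<close> assms by (simp_all add: field_simps)
qed

section \<open>Residuals, the group and the likelihood\<close>

locale sampled_rdag =
  fixes E :: "('m::{finite,wellorder} \<times> 'm) set"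
    and c :: "'m \<Rightarrow> 'm \<Rightarrow> 'c"
    and Y :: "real^'n^'m::{finite,wellorder}"
  assumes dag: "ordered_dag E"
    and compatible: "compatible_colouring E c"
begin

abbreviation L where "L \<equiv> edge_matrices E c"
abbreviation V where "V \<equiv> vertex_vectors c"
abbreviation model where "model \<equiv> rdag_model E c"
abbreviation G where "G \<equiv> coloured_matrices_SL E c"

text \<open>The part of the sample that the edge weights \<open>\<Lambda>\<close> leave unexplained.\<close>

definition residual where
  "residual \<Lambda> = Y - \<Lambda> ** Y"

text \<open>Some edge weights explain all rows of one vertex colour, that of \<open>v\<close>, without error.\<close>

definition degenerate :: bool where
  "degenerate \<longleftrightarrow> (\<exists>\<Lambda>\<in>L. \<exists>v. \<forall>i. c i i = c v v \<longrightarrow> residual \<Lambda> $ i = 0)"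

lemma residual_eq: "residual \<Lambda> = (mat 1 - \<Lambda>) ** Y"
  by (simp add: residual_def matrix_mult_diff_left)

lemma edge_less: "(j, i) \<in> E \<Longrightarrow> i < j"
  using dag unfolding ordered_dag_def by blast

lemma edge_matrix_diag [simp]: "\<Lambda> \<in> L \<Longrightarrow> \<Lambda> $ i $ i = 0"
  using edge_less edge_matrices_zero by blast

lemma edge_matrix_lower: "\<Lambda> \<in> L \<Longrightarrow> j < i \<Longrightarrow> \<Lambda> $ i $ j = 0"
  using edge_less[of j i] edge_matrices_zero by force

text \<open>Compatibility of the colouring is essential here: edges of equal colour end in vertices of equal
  colour, so their weights are scaled by the same factor.\<close>

lemma edge_matrices_scale_rows:
  assumes "\<Lambda> \<in> L" "d \<in> V"
  shows "vdiag d ** \<Lambda> \<in> L"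
proof -
  have d_eq: "d $ i = d $ k" if "(j, i) \<in> E" "(l, k) \<in> E" "c i j = c k l" for i j k l
    using that compatible vertex_vectorsD[OF \<open>d \<in> V\<close>] unfolding compatible_colouring_def by blast
  show ?thesis
  proof (rule edge_matricesI)
    fix i j k l assume e: "(j, i) \<in> E" "(l, k) \<in> E" "c i j = c k l"
    show "(vdiag d ** \<Lambda>) $ i $ j = (vdiag d ** \<Lambda>) $ k $ l"
      using edge_matrices_colour[OF \<open>\<Lambda> \<in> L\<close> e] d_eq[OF e] by (simp add: vdiag_mult_row)
  qed (simp add: vdiag_mult_row edge_matrices_zero[OF \<open>\<Lambda> \<in> L\<close>])
qed

lemma det_unipotent: "\<Lambda> \<in> L \<Longrightarrow> det (mat 1 - \<Lambda>) = 1"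
  by (subst det_upperdiagonal) (auto simp: mat_def edge_matrix_lower)

text \<open>Dividing each row of a group element by its diagonal entry leaves a unipotent matrix.
  Conversely, since vertex and edge colours are disjoint, the diagonal and the off-diagonal
  entries of such a product may be coloured separately.\<close>

lemma SL_iff:
  "a \<in> G \<longleftrightarrow> (\<exists>d\<in>V. \<exists>\<Lambda>\<in>L. (\<Prod>i\<in>UNIV. d $ i) = 1 \<and> a = vdiag d ** (mat 1 - \<Lambda>))"
proof
  assume a: "a \<in> G"
  define d where "d = (\<chi> i. a $ i $ i)"
  have d: "d \<in> V"
    by (rule vertex_vectorsI, unfold d_def vec_lambda_beta)
      (use a in \<open>unfold coloured_matrices_SL_def coloured_matrices_def, blast\<close>)
  have zero: "a $ i $ j = 0" if "i \<noteq> j" "(j, i) \<notin> E" for i j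
    using a that unfolding coloured_matrices_SL_def coloured_matrices_def by blast
  have "det a = (\<Prod>i\<in>UNIV. d $ i)"
    unfolding d_def by (subst det_upperdiagonal) (use zero edge_less in \<open>force\<close>, simp)
  then have prod: "(\<Prod>i\<in>UNIV. d $ i) = 1"
    using a by (simp add: coloured_matrices_SL_def)
  then have nz: "d $ i \<noteq> 0" for i
    by (metis UNIV_I finite prod_zero zero_neq_one)
  define N where "N = (\<chi> i j. if i = j then 0 else - a $ i $ j)"
  have "N \<in> L"
  proof (rule edge_matricesI)
    fix i j assume "(j, i) \<notin> E"
    then show "N $ i $ j = 0"
      using zero by (simp add: N_def)
  next
    fix i j k l assume e: "(j, i) \<in> E" "(l, k) \<in> E" "c i j = c k l"
    then have "a $ i $ j = a $ k $ l"
      using a unfolding coloured_matrices_SL_def coloured_matrices_def by blast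
    moreover have "i \<noteq> j" "k \<noteq> l"
      using e edge_less by blast+
    ultimately show "N $ i $ j = N $ k $ l"
      by (simp add: N_def)
  qed
  moreover have "(\<chi> i. 1 / d $ i) \<in> V"
    by (rule vertex_vectorsI, unfold vec_lambda_beta) (metis vertex_vectorsD[OF d])
  ultimately have "vdiag (\<chi> i. 1 / d $ i) ** N \<in> L"
    by (rule edge_matrices_scale_rows)
  moreover have "a = vdiag d ** (mat 1 - vdiag (\<chi> i. 1 / d $ i) ** N)"
    using nz by (simp add: vec_eq_iff vdiag_mult_row N_def mat_def d_def)
  ultimately show "\<exists>d\<in>V. \<exists>\<Lambda>\<in>L. (\<Prod>i\<in>UNIV. d $ i) = 1 \<and> a = vdiag d ** (mat 1 - \<Lambda>)"
    using d prod by blast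
next
  assume "\<exists>d\<in>V. \<exists>\<Lambda>\<in>L. (\<Prod>i\<in>UNIV. d $ i) = 1 \<and> a = vdiag d ** (mat 1 - \<Lambda>)"
  then obtain d \<Lambda> where d: "d \<in> V" and \<Lambda>: "\<Lambda> \<in> L" and prod: "(\<Prod>i\<in>UNIV. d $ i) = 1"
    and a: "a = vdiag d ** (mat 1 - \<Lambda>)"
    by blast
  have det: "det a = 1"
    by (simp add: a det_mul det_vdiag prod det_unipotent \<Lambda>)
  have a_nth: "a $ i $ j = (if i = j then d $ i else - (vdiag d ** \<Lambda>) $ i $ j)" for i j
    using \<Lambda> by (auto simp: a vdiag_mult_row mat_def)
  have N: "vdiag d ** \<Lambda> \<in> L"
    using \<Lambda> d by (rule edge_matrices_scale_rows)
  have "a $ i $ j = 0" if "i \<noteq> j" "(j, i) \<notin> E" for i j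
    using that by (simp add: a_nth edge_matrices_zero[OF N])
  moreover have "a $ i $ j = a $ k $ l"
    if e: "i = j \<or> (j, i) \<in> E" "k = l \<or> (l, k) \<in> E" "c i j = c k l" for i j k l
  proof -
    consider "i = j" "k = l" | "i = j" "(l, k) \<in> E" | "(j, i) \<in> E" "k = l" | "(j, i) \<in> E" "(l, k) \<in> E"
      using e by blast
    then show ?thesis
    proof cases
      case 1
      then show ?thesis
        using vertex_vectorsD[OF d, of i k] e(3) by (simp add: a_nth)
    next
      case 2
      then show ?thesis
        using e(3) compatible unfolding compatible_colouring_def by metis
    next
      case 3
      then show ?thesis
        using e(3) compatible unfolding compatible_colouring_def by metis
    next
      case 4
      then have "i \<noteq> j" "k \<noteq> l"
        using edge_less by blast+
      then show ?thesis
        using edge_matrices_colour[OF N 4 e(3)] by (simp add: a_nth)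
    qed
  qed
  moreover have "invertible a"
    by (simp add: invertible_det_nz det)
  ultimately show "a \<in> G"
    using det unfolding coloured_matrices_SL_def coloured_matrices_def by blast
qed

lemma SL_orbit: "orbit_of G Y =
    {vdiag d ** residual \<Lambda> | d \<Lambda>. d \<in> V \<and> \<Lambda> \<in> L \<and> (\<Prod>i\<in>UNIV. d $ i) = 1}"
proof -
  have "G = {vdiag d ** (mat 1 - \<Lambda>) | d \<Lambda>. d \<in> V \<and> \<Lambda> \<in> L \<and> (\<Prod>i\<in>UNIV. d $ i) = 1}"
    using SL_iff by blast
  then show ?thesis
    unfolding orbit_of_def residual_eq matrix_mul_assoc by auto
qed

lemma log_likelihood_precision:
  assumes "\<Lambda> \<in> L" "\<And>i. \<omega> $ i > 0"
  shows "log_likelihood Y (precision \<Lambda> \<omega>)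
    = - (\<Sum>i\<in>UNIV. ln (\<omega> $ i) + (norm (residual \<Lambda> $ i))\<^sup>2 / (real CARD('n) * \<omega> $ i))"
proof -
  have "det (precision \<Lambda> \<omega>) = (\<Prod>i\<in>UNIV. 1 / \<omega> $ i)"
    by (simp add: precision_def det_mul det_transpose det_unipotent[OF assms(1)] det_vdiag)
  then have "ln (det (precision \<Lambda> \<omega>)) = - (\<Sum>i\<in>UNIV. ln (\<omega> $ i))"
    using ln_prod[of UNIV "\<lambda>i. 1 / \<omega> $ i"] less_imp_neq[OF assms(2), symmetric] assms(2)
    by (simp add: ln_div sum_negf)
  moreover have "trace (precision \<Lambda> \<omega> ** sample_cov Y)
      = 1 / real CARD('n) * trace (precision \<Lambda> \<omega> ** (Y ** transpose Y))"
    by (simp add: sample_cov_def trace_def matrix_matrix_mult_def sum_distrib_left mult_ac)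
  ultimately show ?thesis
    unfolding log_likelihood_def precision_def trace_congruence_vdiag
    by (simp add: residual_eq sum.distrib sum_distrib_left mult.commute divide_divide_eq_left)
qed


lemma residual_zero: "residual 0 = Y"
  by (simp add: residual_def)

section \<open>The degenerate case\<close>

lemma not_bdd_above_if_degenerate:
  assumes degenerate
  shows "\<not> bdd_above (log_likelihood Y ` model)"
proof
  assume "bdd_above (log_likelihood Y ` model)"
  then obtain B where B: "\<And>\<Psi>. \<Psi> \<in> model \<Longrightarrow> log_likelihood Y \<Psi> \<le> B"
    unfolding bdd_above_def by blast
  obtain \<Lambda> v where \<Lambda>: "\<Lambda> \<in> L" and v: "\<And>i. c i i = c v v \<Longrightarrow> residual \<Lambda> $ i = 0"
    using assms unfolding degenerate_def by blast
  define C where "C = (\<Sum>i\<in>UNIV. (norm (residual \<Lambda> $ i))\<^sup>2 / real CARD('n))"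
  \<comment> \<open>With variance \<open>exp (- T)\<close> on the perfectly explained colour and \<open>1\<close> elsewhere, the log-likelihood
    is at least \<open>T - C\<close>.\<close>
  define T where "T = \<bar>B\<bar> + C + 1"
  have "C \<ge> 0"
    unfolding C_def by (intro sum_nonneg) simp
  then have "T \<ge> 0"
    by (simp add: T_def)
  define \<omega> where "\<omega> = (\<chi> i. if c i i = c v v then exp (- T) else 1)"
  have pos: "\<omega> $ i > 0" for i
    by (simp add: \<omega>_def)
  have "\<omega> \<in> V"
    by (rule vertex_vectorsI) (simp add: \<omega>_def)
  then have "precision \<Lambda> \<omega> \<in> model"
    using \<Lambda> pos unfolding rdag_model_eq by blast
  moreover have "log_likelihood Y (precision \<Lambda> \<omega>) = T * real (card {i. c i i = c v v}) - C"
  proof -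
    have "ln (\<omega> $ i) + (norm (residual \<Lambda> $ i))\<^sup>2 / (real CARD('n) * \<omega> $ i)
        = (if c i i = c v v then - T else 0) + (norm (residual \<Lambda> $ i))\<^sup>2 / real CARD('n)" for i
      by (simp add: \<omega>_def v)
    then show ?thesis
      unfolding log_likelihood_precision[OF \<Lambda> pos] C_def
      by (simp add: sum.distrib sum.If_cases)
  qed
  moreover have "T * 1 \<le> T * real (card {i. c i i = c v v})"
  proof (rule mult_left_mono)
    have "card {i. c i i = c v v} > 0"
      by (subst card_gt_0_iff) auto
    then show "1 \<le> real (card {i. c i i = c v v})"
      by linarith
  qed fact
  ultimately show False
    using B[of "precision \<Lambda> \<omega>"] by (simp add: T_def)
qed

lemma unstable_if_degenerate:
  assumes degenerate
  shows "unstable_under G Y"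
proof -
  obtain \<Lambda> v where \<Lambda>: "\<Lambda> \<in> L" and v: "\<And>i. c i i = c v v \<Longrightarrow> residual \<Lambda> $ i = 0"
    using assms unfolding degenerate_def by blast
  define S where "S = {i. c i i = c v v}"
  define t :: "nat \<Rightarrow> real" where "t k = inverse (real (Suc k))" for k
  \<comment> \<open>The factor \<open>t k\<close> to the power \<open>card S\<close> shrinks the rows outside \<open>S\<close>; the factor on \<open>S\<close>,
    where the residual vanishes, restores determinant \<open>1\<close>.\<close>
  define d where "d k = (\<chi> i. if c i i = c v v then inverse (t k) ^ card (- S) else t k ^ card S)" for k
  have "card S > 0"
    unfolding S_def by (subst card_gt_0_iff) auto
  have "t k ^ card S *\<^sub>R residual \<Lambda> \<in> orbit_of G Y" for k
  proof -
    have "d k \<in> V"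
      by (rule vertex_vectorsI) (simp add: d_def)
    moreover have "(\<Prod>i\<in>UNIV. d k $ i) = 1"
    proof -
      have "(\<Prod>i\<in>UNIV. d k $ i) = (inverse (t k) ^ card (- S)) ^ card S * (t k ^ card S) ^ card (- S)"
        unfolding d_def S_def by (simp add: prod.If_cases Collect_neg_eq)
      also have "\<dots> = (inverse (t k) * t k) ^ (card S * card (- S))"
        by (simp add: power_mult_distrib power_mult[symmetric] mult.commute)
      also have "\<dots> = 1"
        by (simp add: t_def)
      finally show ?thesis .
    qed
    moreover have "t k ^ card S *\<^sub>R residual \<Lambda> = vdiag (d k) ** residual \<Lambda>"
    proof -
      have "(t k ^ card S *\<^sub>R residual \<Lambda>) $ i = (vdiag (d k) ** residual \<Lambda>) $ i" for i
        by (simp add: vdiag_mult_row d_def v)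
      then show ?thesis
        by (simp add: vec_eq_iff)
    qed
    ultimately show ?thesis
      using \<Lambda> unfolding SL_orbit by blast
  qed
  moreover have "(\<lambda>k. t k ^ card S *\<^sub>R residual \<Lambda>) \<longlonglongrightarrow> 0 ^ card S *\<^sub>R residual \<Lambda>"
    unfolding t_def by (intro tendsto_intros LIMSEQ_inverse_real_of_nat)
  moreover have "0 ^ card S *\<^sub>R residual \<Lambda> = 0"
    by (simp only: zero_power[OF \<open>card S > 0\<close>] scaleR_zero_left)
  ultimately show ?thesis
    unfolding unstable_under_def closure_sequential
    by (intro exI[of _ "\<lambda>k. t k ^ card S *\<^sub>R residual \<Lambda>"]) simp
qed

section \<open>Least squares\<close>

text \<open>Edge weights that minimise the total residual.\<close>

definition least_squares :: "_ \<Rightarrow> bool" where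
  "least_squares \<Lambda> \<longleftrightarrow> \<Lambda> \<in> L \<and> (\<forall>N\<in>L. norm (residual \<Lambda>) \<le> norm (residual N))"

text \<open>The residual sum of squares over all vertices with the same colour as \<open>v\<close>.\<close>

definition colour_residual where
  "colour_residual \<Lambda> v = (\<Sum>i | c i i = c v v. (norm (residual \<Lambda> $ i))\<^sup>2)"

lemma subspace_fitted: "subspace ((\<lambda>\<Lambda>. \<Lambda> ** Y) ` L)"
proof (rule linear_subspace_image[OF _ subspace_edge_matrices])
  show "linear (\<lambda>\<Lambda>. \<Lambda> ** Y)"
    by (rule linearI) (simp_all add: matrix_mult_add_left matrix_mult_scaleR_left)
qed

lemma least_squares_exists: "\<exists>\<Lambda>. least_squares \<Lambda>"
proof -
  let ?W = "(\<lambda>\<Lambda>. \<Lambda> ** Y) ` L"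
  have "?W \<noteq> {}"
    using subspace_0[OF subspace_fitted] by blast
  then obtain w where w: "w \<in> ?W" "\<And>z. z \<in> ?W \<Longrightarrow> dist Y w \<le> dist Y z"
    using distance_attains_inf[OF closed_subspace[OF subspace_fitted]] by blast
  then show ?thesis
    unfolding least_squares_def residual_def dist_norm by blast
qed

text \<open>A weight matrix that is better on one colour could be spliced into the minimiser: rows of
  different vertex colours share no edge colour.\<close>

lemma least_squares_colourwise:
  assumes "least_squares \<Lambda>" "N \<in> L"
  shows "colour_residual \<Lambda> v \<le> colour_residual N v"
proof -
  define p :: "real^'m::{finite,wellorder}" where "p = (\<chi> i. if c i i = c v v then 1 else 0)"
  define q :: "real^'m::{finite,wellorder}" where "q = (\<chi> i. if c i i = c v v then 0 else 1)"
  define M where "M = vdiag p ** N + vdiag q ** \<Lambda>"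
  let ?S = "{i. c i i = c v v}"
  have "p \<in> V" "q \<in> V"
    by (rule vertex_vectorsI, simp add: p_def q_def)+
  then have "M \<in> L"
    using assms subspace_add[OF subspace_edge_matrices] edge_matrices_scale_rows
    unfolding M_def least_squares_def by blast
  then have "(norm (residual \<Lambda>))\<^sup>2 \<le> (norm (residual M))\<^sup>2"
    using assms(1) by (simp add: least_squares_def)
  moreover have "residual M $ i = (if c i i = c v v then residual N $ i else residual \<Lambda> $ i)" for i
    unfolding residual_def M_def
    by (simp add: matrix_mult_add_left vdiag_mult_row p_def q_def flip: matrix_mul_assoc)
  ultimately have "(\<Sum>i\<in>UNIV. (norm (residual \<Lambda> $ i))\<^sup>2)
      \<le> (\<Sum>i\<in>UNIV. if c i i = c v v then (norm (residual N $ i))\<^sup>2 else (norm (residual \<Lambda> $ i))\<^sup>2)"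
    unfolding norm_matrix_sq by (simp add: if_distrib[of "\<lambda>x. (norm x)\<^sup>2"])
  also have "\<dots> = colour_residual N v + (\<Sum>i\<in>- ?S. (norm (residual \<Lambda> $ i))\<^sup>2)"
    by (simp add: sum.If_cases colour_residual_def)
  also have "(\<Sum>i\<in>UNIV. (norm (residual \<Lambda> $ i))\<^sup>2) = colour_residual \<Lambda> v + (\<Sum>i\<in>- ?S. (norm (residual \<Lambda> $ i))\<^sup>2)"
    unfolding colour_residual_def by (subst sum.union_disjoint[symmetric]) auto
  finally show ?thesis
    by simp
qed

lemma colour_residual_pos:
  assumes "\<not> degenerate" "\<Lambda> \<in> L"
  shows "colour_residual \<Lambda> v > 0"
proof -
  obtain i where i: "c i i = c v v" "residual \<Lambda> $ i \<noteq> 0"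
    using assms unfolding degenerate_def by blast
  then show ?thesis
    unfolding colour_residual_def by (intro sum_pos2[of _ i]) auto
qed

section \<open>Orbits and stabilisers\<close>

text \<open>The minimal colour residuals control the diagonal of a group element by the norm of the
  orbit point.\<close>

lemma diag_entry_bound:
  assumes "\<not> degenerate"
  obtains m where "m > 0"
    and "\<And>d \<Lambda> v. d \<in> V \<Longrightarrow> \<Lambda> \<in> L \<Longrightarrow> \<bar>d $ v\<bar> * m \<le> norm (vdiag d ** residual \<Lambda>)"
proof -
  obtain \<Lambda>0 where \<Lambda>0: "least_squares \<Lambda>0"
    using least_squares_exists by blast
  define \<mu> where "\<mu> = Min (range (colour_residual \<Lambda>0))"
  have "\<mu> \<in> range (colour_residual \<Lambda>0)"
    unfolding \<mu>_def by (rule Min_in) auto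
  then have "\<mu> > 0"
    using colour_residual_pos[OF assms] \<Lambda>0 by (auto simp: least_squares_def)
  have "\<bar>d $ v\<bar> * sqrt \<mu> \<le> norm (vdiag d ** residual \<Lambda>)" if d: "d \<in> V" and \<Lambda>: "\<Lambda> \<in> L" for d \<Lambda> v
  proof -
    have "\<mu> \<le> colour_residual \<Lambda>0 v"
      unfolding \<mu>_def by (rule Min_le) auto
    also have "\<dots> \<le> colour_residual \<Lambda> v"
      using \<Lambda>0 \<Lambda> by (rule least_squares_colourwise)
    finally have "(d $ v)\<^sup>2 * \<mu> \<le> (d $ v)\<^sup>2 * colour_residual \<Lambda> v"
      by (intro mult_left_mono) auto
    also have "\<dots> = (\<Sum>i | c i i = c v v. (norm ((vdiag d ** residual \<Lambda>) $ i))\<^sup>2)"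
      unfolding colour_residual_def sum_distrib_left
    proof (rule sum.cong[OF refl])
      fix i assume "i \<in> {i. c i i = c v v}"
      then have "d $ i = d $ v"
        using vertex_vectorsD[OF d] by blast
      then show "(d $ v)\<^sup>2 * (norm (residual \<Lambda> $ i))\<^sup>2 = (norm ((vdiag d ** residual \<Lambda>) $ i))\<^sup>2"
        by (simp add: vdiag_mult_row power_mult_distrib)
    qed
    also have "\<dots> \<le> (norm (vdiag d ** residual \<Lambda>))\<^sup>2"
      unfolding norm_matrix_sq by (intro sum_mono2) auto
    finally have "(\<bar>d $ v\<bar> * sqrt \<mu>)\<^sup>2 \<le> (norm (vdiag d ** residual \<Lambda>))\<^sup>2"
      using \<open>\<mu> > 0\<close> by (simp add: power_mult_distrib)
    then show ?thesis
      by (rule power2_le_imp_le) simp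
  qed
  then show thesis
    using that[of "sqrt \<mu>"] \<open>\<mu> > 0\<close> by simp
qed

text \<open>Along a convergent sequence of orbit points the diagonals are bounded, hence converge on a
  subsequence to a diagonal of product \<open>1\<close>. Dividing by it, the residuals converge as well, and
  the residuals form a closed affine space.\<close>

lemma closed_orbit:
  assumes "\<not> degenerate"
  shows "closed (orbit_of G Y)"
  unfolding closed_sequential_limits
proof (intro allI impI, elim conjE)
  fix x z assume x: "\<forall>k. x k \<in> orbit_of G Y" and z: "x \<longlonglongrightarrow> z"
  obtain m where "m > 0"
    and m: "\<And>d \<Lambda> v. d \<in> V \<Longrightarrow> \<Lambda> \<in> L \<Longrightarrow> \<bar>d $ v\<bar> * m \<le> norm (vdiag d ** residual \<Lambda>)"
    using diag_entry_bound[OF assms] by blast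
  have "\<forall>k. \<exists>d \<Lambda>. d \<in> V \<and> \<Lambda> \<in> L \<and> (\<Prod>i\<in>UNIV. d $ i) = 1 \<and> x k = vdiag d ** residual \<Lambda>"
    using x unfolding SL_orbit by blast
  then obtain d \<Lambda> where d: "\<And>k. d k \<in> V" and \<Lambda>: "\<And>k. \<Lambda> k \<in> L"
    and prod: "\<And>k. (\<Prod>i\<in>UNIV. d k $ i) = 1" and xk: "\<And>k. x k = vdiag (d k) ** residual (\<Lambda> k)"
    by metis
  obtain B where B: "\<And>k. norm (x k) \<le> B"
    using z by (metis convergent_def convergent_imp_Bseq BseqE)
  have "norm (d k) \<le> real CARD('m) * (B / m)" for k
  proof -
    have "norm (d k $ i) \<le> B / m" for i
      using m[OF d \<Lambda>, of k i k] B[of k] \<open>m > 0\<close> by (simp add: xk pos_le_divide_eq)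
    then have "(\<Sum>i\<in>UNIV. norm (d k $ i)) \<le> (\<Sum>i\<in>(UNIV::'m set). B / m)"
      by (intro sum_mono) auto
    then show ?thesis
      using norm_le_l1_cart[of "d k"] by simp
  qed
  then have "bounded (range d)"
    unfolding bounded_iff by blast
  then obtain e r where r: "strict_mono r" and e: "(d \<circ> r) \<longlonglongrightarrow> e"
    using bounded_imp_convergent_subsequence by blast
  have e_nth: "(\<lambda>k. d (r k) $ i) \<longlonglongrightarrow> e $ i" for i
    using tendsto_vec_nth[OF e, of i] by (simp add: o_def)
  have "e \<in> V"
  proof (rule vertex_vectorsI)
    fix i j assume ij: "c i i = c j j"
    have "(\<lambda>k. d (r k) $ i) = (\<lambda>k. d (r k) $ j)"
      using vertex_vectorsD[OF d ij] by blast
    then show "e $ i = e $ j"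
      using LIMSEQ_unique[OF e_nth[of i]] e_nth[of j] by simp
  qed
  have "(\<lambda>k. \<Prod>i\<in>UNIV. d (r k) $ i) \<longlonglongrightarrow> (\<Prod>i\<in>UNIV. e $ i)"
    by (intro tendsto_prod e_nth)
  then have prod_e: "(\<Prod>i\<in>UNIV. e $ i) = 1"
    by (simp add: prod LIMSEQ_const_iff)
  then have nz: "e $ i \<noteq> 0" for i
    by (metis UNIV_I finite prod_zero zero_neq_one)
  have d_nz: "d k $ i \<noteq> 0" for k i
    using prod[of k] by (metis UNIV_I finite prod_zero zero_neq_one)
  define y where "y = (\<chi> i. (1 / e $ i) *\<^sub>R z $ i)"
  have "(\<lambda>k. residual (\<Lambda> (r k))) \<longlonglongrightarrow> y"
  proof (rule vec_tendstoI)
    fix i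
    have "(\<lambda>k. x (r k) $ i) \<longlonglongrightarrow> z $ i"
      using tendsto_vec_nth[OF LIMSEQ_subseq_LIMSEQ[OF z r], of i] by (simp add: o_def)
    then have "(\<lambda>k. (1 / d (r k) $ i) *\<^sub>R x (r k) $ i) \<longlonglongrightarrow> (1 / e $ i) *\<^sub>R z $ i"
      by (intro tendsto_scaleR tendsto_divide tendsto_const e_nth nz)
    moreover have "(1 / d k $ i) *\<^sub>R x k $ i = residual (\<Lambda> k) $ i" for k
      using d_nz by (simp add: xk vdiag_mult_row)
    ultimately show "(\<lambda>k. residual (\<Lambda> (r k)) $ i) \<longlonglongrightarrow> y $ i"
      by (simp add: y_def)
  qed
  then have lim: "(\<lambda>k. Y - residual (\<Lambda> (r k))) \<longlonglongrightarrow> Y - y"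
    by (intro tendsto_intros)
  have "Y - residual (\<Lambda> k) \<in> (\<lambda>\<Lambda>. \<Lambda> ** Y) ` L" for k
    using \<Lambda> by (simp add: residual_def)
  then have "Y - y \<in> (\<lambda>\<Lambda>. \<Lambda> ** Y) ` L"
    by (rule closed_sequentially[OF closed_subspace[OF subspace_fitted] _ lim])
  then obtain N where "N \<in> L" "Y - y = N ** Y"
    by blast
  then have "y = residual N"
    by (simp add: residual_def algebra_simps)
  moreover have "z = vdiag e ** y"
    using nz by (simp add: vec_eq_iff vdiag_mult_row y_def)
  ultimately show "z \<in> orbit_of G Y"
    using \<open>e \<in> V\<close> \<open>N \<in> L\<close> prod_e unfolding SL_orbit by blast
qed

lemma zero_notin_orbit:
  assumes "\<not> degenerate"
  shows "0 \<notin> orbit_of G Y"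
proof
  assume "0 \<in> orbit_of G Y"
  then obtain d \<Lambda> where "\<Lambda> \<in> L" "(\<Prod>i\<in>UNIV. d $ i) = 1" and 0: "0 = vdiag d ** residual \<Lambda>"
    unfolding SL_orbit by blast
  then have "d $ i \<noteq> 0" for i
    by (metis UNIV_I finite prod_zero zero_neq_one)
  then have "residual \<Lambda> $ i = 0" for i
    using vdiag_mult_row[of d "residual \<Lambda>" i] unfolding 0[symmetric] by simp
  then show False
    using assms \<open>\<Lambda> \<in> L\<close> unfolding degenerate_def by blast
qed

lemma unstable_iff: "unstable_under G Y \<longleftrightarrow> degenerate"
  using unstable_if_degenerate closed_orbit zero_notin_orbit
  unfolding unstable_under_def by (metis closure_closed)

lemma polystable_iff: "polystable_under G Y \<longleftrightarrow> \<not> degenerate"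
proof
  assume "\<not> degenerate"
  moreover from this have "Y \<noteq> 0"
    using subspace_0[OF subspace_edge_matrices, of E c] residual_zero
    unfolding degenerate_def by force
  ultimately show "polystable_under G Y"
    using closed_orbit unfolding polystable_under_def by blast
next
  assume poly: "polystable_under G Y"
  show "\<not> degenerate"
  proof
    assume degenerate
    then have "0 \<in> orbit_of G Y"
      using poly unstable_if_degenerate unfolding polystable_under_def unstable_under_def by simp
    then obtain a where "a \<in> G" and a: "a ** Y = 0"
      unfolding orbit_of_def by auto
    then obtain b where "b ** a = mat 1"
      unfolding coloured_matrices_SL_def coloured_matrices_def invertible_def by blast
    then have "Y = b ** (a ** Y)"
      by (simp add: matrix_mul_assoc)
    then have "Y = 0"
      by (simp add: a)
    then show False
      using poly by (simp add: polystable_under_def)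
  qed
qed

text \<open>A nonzero kernel element \<open>N\<close> yields the line \<open>1 - t N\<close> in the stabiliser. Without kernel the
  stabiliser is trivial: a diagonal factor other than \<open>1\<close> on some colour would express the rows
  of \<open>Y\<close> of that colour through their parents, which is degeneracy.\<close>

lemma finite_stabilizer_iff:
  assumes "\<not> degenerate"
  shows "finite (stabilizer_of G Y) \<longleftrightarrow> (\<forall>N\<in>L. N ** Y = 0 \<longrightarrow> N = 0)"
proof
  assume fin: "finite (stabilizer_of G Y)"
  show "\<forall>N\<in>L. N ** Y = 0 \<longrightarrow> N = 0"
  proof (intro ballI impI, rule ccontr)
    fix N assume N: "N \<in> L" "N ** Y = 0" "N \<noteq> 0"
    have "mat 1 - t *\<^sub>R N \<in> stabilizer_of G Y" for t
    proof -
      have "t *\<^sub>R N \<in> L"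
        using N(1) subspace_scale[OF subspace_edge_matrices] by blast
      moreover have "(\<chi> i. 1) \<in> V"
        by (rule vertex_vectorsI) simp
      ultimately have "mat 1 - t *\<^sub>R N \<in> G"
        unfolding SL_iff by (intro bexI[of _ "\<chi> i. 1"] bexI[of _ "t *\<^sub>R N"]) (simp_all add: vdiag_one)
      moreover have "(t *\<^sub>R N) ** Y = t *\<^sub>R (N ** Y)"
        by (rule matrix_mult_scaleR_left)
      ultimately show ?thesis
        using N(2) by (simp add: stabilizer_of_def matrix_mult_diff_left)
    qed
    then have "finite (range (\<lambda>t. mat 1 - t *\<^sub>R N))"
      using fin by (meson finite_subset image_subsetI)
    moreover have "inj (\<lambda>t. mat 1 - t *\<^sub>R N)"
      using N(3) by (simp add: inj_def)
    ultimately show False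
      using finite_imageD infinite_UNIV_char_0 by blast
  qed
next
  assume ker: "\<forall>N\<in>L. N ** Y = 0 \<longrightarrow> N = 0"
  have "stabilizer_of G Y \<subseteq> {mat 1}"
  proof
    fix a assume "a \<in> stabilizer_of G Y"
    then obtain d \<Lambda> where d: "d \<in> V" and \<Lambda>: "\<Lambda> \<in> L" and prod: "(\<Prod>i\<in>UNIV. d $ i) = 1"
      and a: "a = vdiag d ** (mat 1 - \<Lambda>)" "a ** Y = Y"
      unfolding stabilizer_of_def SL_iff by blast
    have row: "d $ i *\<^sub>R residual \<Lambda> $ i = Y $ i" for i
      using a vdiag_mult_row[of d "residual \<Lambda>" i] by (simp add: residual_eq matrix_mul_assoc)
    have nz: "d $ i \<noteq> 0" for i
      using prod by (metis UNIV_I finite prod_zero zero_neq_one)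
    have d1: "d $ v = 1" for v
    proof (rule ccontr)
      assume v: "d $ v \<noteq> 1"
      \<comment> \<open>From \<open>d\<^sub>v (Y - \<Lambda> Y) = Y\<close> on the colour of \<open>v\<close>, solving for \<open>Y\<close> there gives \<open>Y = ?r \<Lambda> Y\<close>.\<close>
      let ?r = "d $ v / (d $ v - 1)"
      have "residual (?r *\<^sub>R \<Lambda>) $ i = 0" if "c i i = c v v" for i
      proof -
        have "(?r *\<^sub>R \<Lambda>) ** Y = ?r *\<^sub>R (\<Lambda> ** Y)"
          by (rule matrix_mult_scaleR_left)
        then have res: "residual (?r *\<^sub>R \<Lambda>) $ i = Y $ i - ?r *\<^sub>R (\<Lambda> ** Y) $ i"
          by (simp add: residual_def)
        have "d $ v *\<^sub>R (Y $ i - (\<Lambda> ** Y) $ i) = Y $ i"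
          using row[of i] vertex_vectorsD[OF d that] by (simp add: residual_def)
        then have "d $ v *\<^sub>R (\<Lambda> ** Y) $ i = (d $ v - 1) *\<^sub>R Y $ i"
          by (simp add: algebra_simps)
        then have "(1 / (d $ v - 1)) *\<^sub>R (d $ v *\<^sub>R (\<Lambda> ** Y) $ i) = Y $ i"
          using v by simp
        then show ?thesis
          by (simp add: res)
      qed
      moreover have "?r *\<^sub>R \<Lambda> \<in> L"
        using \<Lambda> subspace_scale[OF subspace_edge_matrices] by blast
      ultimately show False
        using assms unfolding degenerate_def by blast
    qed
    have "(\<Lambda> ** Y) $ i = 0" for i
      using row[of i] by (simp add: d1 residual_def)
    then have "\<Lambda> = 0"
      using ker \<Lambda> by (simp add: vec_eq_iff)
    moreover have "d = (\<chi> i. 1)"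
      by (simp add: vec_eq_iff d1)
    ultimately show "a \<in> {mat 1}"
      by (simp add: a(1) vdiag_one)
  qed
  then show "finite (stabilizer_of G Y)"
    by (rule finite_subset) simp
qed

section \<open>Maximum likelihood estimation\<close>

text \<open>The mean squared residual over a vertex colour and all samples, as a vector indexed by
  vertices; it is the optimal noise variance for given edge weights.\<close>

definition colour_variance where
  "colour_variance \<Lambda> = (\<chi> i. colour_residual \<Lambda> i / (real CARD('n) * real (card {j. c j j = c i i})))"

lemma colour_variance_vertex_vector: "colour_variance \<Lambda> \<in> V"
  by (rule vertex_vectorsI) (simp add: colour_variance_def colour_residual_def)

lemma colour_card_pos: "card {j. c j j = c i i} > 0"
  by (subst card_gt_0_iff) auto

lemma colour_variance_pos:
  assumes "\<not> degenerate" "\<Lambda> \<in> L"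
  shows "colour_variance \<Lambda> $ i > 0"
  using colour_residual_pos[OF assms, of i] colour_card_pos[of i] by (simp add: colour_variance_def)

lemma least_squares_colour_variance_le:
  assumes "least_squares \<Lambda>" "N \<in> L"
  shows "colour_variance \<Lambda> $ i \<le> colour_variance N $ i"
  using least_squares_colourwise[OF assms, of i] by (simp add: colour_variance_def divide_right_mono)

lemma sum_colour_variance:
  assumes "w \<in> V"
  shows "(\<Sum>i\<in>UNIV. w $ i * colour_variance \<Lambda> $ i)
    = (\<Sum>i\<in>UNIV. w $ i * (norm (residual \<Lambda> $ i))\<^sup>2) / real CARD('n)"
proof -
  have "(\<Sum>i\<in>UNIV. w $ i * (colour_residual \<Lambda> i / real (card {j. c j j = c i i})))
      = (\<Sum>i\<in>UNIV. w $ i * (norm (residual \<Lambda> $ i))\<^sup>2)"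
    unfolding colour_residual_def by (rule sum_colour_average) (rule vertex_vectorsD[OF assms])
  from this[symmetric] show ?thesis
    unfolding colour_variance_def by (simp add: sum_divide_distrib mult.commute)
qed

lemma log_likelihood_colour_variance:
  assumes "\<Lambda> \<in> L" "\<omega> \<in> V" "\<And>i. \<omega> $ i > 0"
  shows "log_likelihood Y (precision \<Lambda> \<omega>)
    = - (\<Sum>i\<in>UNIV. ln (\<omega> $ i) + colour_variance \<Lambda> $ i / \<omega> $ i)"
proof -
  define w where "w = (\<chi> i. 1 / \<omega> $ i)"
  have "w \<in> V"
    by (rule vertex_vectorsI, unfold w_def vec_lambda_beta) (metis vertex_vectorsD[OF assms(2)])
  from sum_colour_variance[OF this, of \<Lambda>]
  have "(\<Sum>i\<in>UNIV. colour_variance \<Lambda> $ i / \<omega> $ i)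
      = (\<Sum>i\<in>UNIV. (norm (residual \<Lambda> $ i))\<^sup>2 / (real CARD('n) * \<omega> $ i))"
    by (simp add: w_def sum_divide_distrib mult.commute)
  then show ?thesis
    by (simp add: log_likelihood_precision[OF assms(1,3)] sum.distrib)
qed

lemma least_squares_maximises:
  assumes "\<not> degenerate" "least_squares \<Lambda>"
    and "N \<in> L" "\<omega> \<in> V" "\<And>i. \<omega> $ i > 0"
  defines "\<Psi> \<equiv> precision \<Lambda> (colour_variance \<Lambda>)"
  shows "log_likelihood Y (precision N \<omega>) \<le> log_likelihood Y \<Psi>"
    and "log_likelihood Y (precision N \<omega>) = log_likelihood Y \<Psi>
      \<Longrightarrow> \<omega> = colour_variance \<Lambda> \<and> norm (residual N) = norm (residual \<Lambda>)"
proof -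
  have \<Lambda>: "\<Lambda> \<in> L"
    using assms(2) by (simp add: least_squares_def)
  let ?q = "colour_variance \<Lambda>" and ?p = "colour_variance N"
  have q: "?q $ i > 0" "?q $ i \<le> ?p $ i" for i
    using colour_variance_pos[OF assms(1) \<Lambda>] least_squares_colour_variance_le[OF assms(2,3)] by auto
  have \<Psi>: "log_likelihood Y \<Psi> = - (\<Sum>i\<in>UNIV. ln (?q $ i) + 1)"
    unfolding \<Psi>_def log_likelihood_colour_variance[OF \<Lambda> colour_variance_vertex_vector q(1)]
    using q(1) by (simp add: less_imp_neq[symmetric])
  have N: "log_likelihood Y (precision N \<omega>) = - (\<Sum>i\<in>UNIV. ln (\<omega> $ i) + ?p $ i / \<omega> $ i)"
    using assms(3-5) by (rule log_likelihood_colour_variance)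
  have le: "ln (?q $ i) + 1 \<le> ln (\<omega> $ i) + ?p $ i / \<omega> $ i" for i
    using q assms(5) by (rule ln_add_divide_ge)
  then show "log_likelihood Y (precision N \<omega>) \<le> log_likelihood Y \<Psi>"
    unfolding \<Psi> N by (simp only: neg_le_iff_le) (intro sum_mono)
  assume "log_likelihood Y (precision N \<omega>) = log_likelihood Y \<Psi>"
  then have "(\<Sum>i\<in>UNIV. ln (?q $ i) + 1) = (\<Sum>i\<in>UNIV. ln (\<omega> $ i) + ?p $ i / \<omega> $ i)"
    unfolding \<Psi> N by simp
  then have "ln (?q $ i) + 1 = ln (\<omega> $ i) + ?p $ i / \<omega> $ i" for i
    by (rule sum_mono_inv[OF _ le]) simp_all
  then have eq: "\<omega> $ i = ?q $ i" "?p $ i = ?q $ i" for i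
    using ln_add_divide_eq[OF q assms(5)] by auto
  have one: "(\<chi> i. 1) \<in> V"
    by (rule vertex_vectorsI) simp
  have "(norm (residual N))\<^sup>2 = (norm (residual \<Lambda>))\<^sup>2"
    using sum_colour_variance[OF one, of N] sum_colour_variance[OF one, of \<Lambda>]
    by (simp add: eq(2) flip: norm_matrix_sq)
  then show "\<omega> = colour_variance \<Lambda> \<and> norm (residual N) = norm (residual \<Lambda>)"
    using eq(1) by (simp add: vec_eq_iff)
qed

lemma least_squares_is_MLE:
  assumes "\<not> degenerate" "least_squares \<Lambda>"
  shows "is_MLE model Y (precision \<Lambda> (colour_variance \<Lambda>))"
proof -
  have "precision \<Lambda> (colour_variance \<Lambda>) \<in> model"
    using assms colour_variance_vertex_vector colour_variance_pos[OF assms(1)]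
    unfolding rdag_model_eq least_squares_def by blast
  then show ?thesis
    using least_squares_maximises(1)[OF assms] unfolding is_MLE_def rdag_model_eq by blast
qed

lemma bdd_above_iff: "bdd_above (log_likelihood Y ` model) \<longleftrightarrow> \<not> degenerate"
  using not_bdd_above_if_degenerate least_squares_exists least_squares_is_MLE
  unfolding is_MLE_def by (metis bdd_above.I2)

lemma MLE_exists_iff: "(\<exists>\<Psi>. is_MLE model Y \<Psi>) \<longleftrightarrow> \<not> degenerate"
  using not_bdd_above_if_degenerate least_squares_exists least_squares_is_MLE
  unfolding is_MLE_def by (metis bdd_above.I2)

text \<open>If the MLE is unique, a kernel element \<open>N\<close> leaves the residual unchanged, so \<open>\<Lambda> + N\<close> and
  \<open>\<Lambda> - N\<close> give the same matrix as \<open>\<Lambda>\<close>. Adding up, the quadratic term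
  \<open>N\<^sup>T diag (1/\<omega>) N\<close> vanishes, which forces \<open>N = 0\<close>. Conversely, every MLE has
  its fitted values at the unique closest point to \<open>Y\<close>, and without kernel these determine the
  edge weights.\<close>

lemma MLE_unique_iff:
  assumes "\<not> degenerate"
  shows "(\<exists>!\<Psi>. is_MLE model Y \<Psi>) \<longleftrightarrow> (\<forall>N\<in>L. N ** Y = 0 \<longrightarrow> N = 0)"
proof -
  obtain \<Lambda> where \<Lambda>: "least_squares \<Lambda>"
    using least_squares_exists by blast
  let ?q = "colour_variance \<Lambda>"
  have "\<Lambda> \<in> L"
    using \<Lambda> by (simp add: least_squares_def)
  show ?thesis
  proof
    assume unique: "\<exists>!\<Psi>. is_MLE model Y \<Psi>"
    show "\<forall>N\<in>L. N ** Y = 0 \<longrightarrow> N = 0"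
    proof (intro ballI impI)
      fix N assume N: "N \<in> L" "N ** Y = 0"
      have shift: "precision (\<Lambda> + M) ?q = precision \<Lambda> ?q" if "M \<in> L" "M ** Y = 0" for M
      proof -
        have res: "residual (\<Lambda> + M) = residual \<Lambda>"
          using that(2) by (simp add: residual_def matrix_mult_add_left)
        moreover have "\<Lambda> + M \<in> L"
          using \<open>\<Lambda> \<in> L\<close> that(1) subspace_add[OF subspace_edge_matrices] by blast
        ultimately have "least_squares (\<Lambda> + M)"
          using \<Lambda> by (simp add: least_squares_def)
        moreover have "colour_variance (\<Lambda> + M) = ?q"
          by (simp add: colour_variance_def colour_residual_def res)
        ultimately show ?thesis
          using unique least_squares_is_MLE[OF assms] \<Lambda> by metis
      qed
      have "- N \<in> L" "(- N) ** Y = 0"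
        using N subspace_neg[OF subspace_edge_matrices] matrix_mult_diff_left[of 0 N Y] by auto
      then have minus: "precision (\<Lambda> + (- N)) ?q = precision \<Lambda> ?q"
        by (rule shift)
      have plus: "precision (\<Lambda> + N) ?q = precision \<Lambda> ?q"
        using N by (rule shift)
      define U where "U = mat 1 - \<Lambda>"
      define D where "D = vdiag (\<chi> i. 1 / ?q $ i)"
      have "U - N = mat 1 - (\<Lambda> + N)" "U + N = mat 1 - (\<Lambda> + (- N))"
        by (simp_all add: U_def)
      then have "transpose (U - N) ** D ** (U - N) = transpose U ** D ** U"
        "transpose (U + N) ** D ** (U + N) = transpose U ** D ** U"
        using plus minus by (simp_all only: precision_def D_def U_def)
      moreover have "transpose (U - N) ** D ** (U - N) + transpose (U + N) ** D ** (U + N)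
          = 2 *\<^sub>R (transpose U ** D ** U) + 2 *\<^sub>R (transpose N ** D ** N)"
        by (simp add: matrix_mult_add_left matrix_add_ldistrib matrix_mult_diff_left
            matrix_mult_diff_right transpose_add transpose_diff scaleR_2)
      ultimately have "2 *\<^sub>R (transpose N ** D ** N) = 0"
        unfolding scaleR_2 by simp
      then have "transpose N ** vdiag (\<chi> i. 1 / ?q $ i) ** N = 0"
        unfolding D_def scaleR_eq_0_iff by simp
      then show "N = 0"
        by (rule congruence_vdiag_eq_0)
          (simp add: colour_variance_pos[OF assms \<open>\<Lambda> \<in> L\<close>])
    qed
  next
    assume ker: "\<forall>N\<in>L. N ** Y = 0 \<longrightarrow> N = 0"
    have "\<Psi> = precision \<Lambda> ?q" if MLE: "is_MLE model Y \<Psi>" for \<Psi>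
    proof -
      obtain N \<omega> where N: "N \<in> L" "\<omega> \<in> V" "\<And>i. \<omega> $ i > 0" and \<Psi>: "\<Psi> = precision N \<omega>"
        using MLE unfolding is_MLE_def rdag_model_eq by blast
      have "log_likelihood Y \<Psi> = log_likelihood Y (precision \<Lambda> ?q)"
        using MLE least_squares_is_MLE[OF assms \<Lambda>] unfolding is_MLE_def by (meson order_antisym)
      then have \<omega>: "\<omega> = ?q" and norm: "norm (residual N) = norm (residual \<Lambda>)"
        using least_squares_maximises(2)[OF assms \<Lambda> N] unfolding \<Psi> by auto
      have "N ** Y = \<Lambda> ** Y"
      proof (rule any_closest_point_unique)
        show "convex ((\<lambda>\<Lambda>. \<Lambda> ** Y) ` L)" "closed ((\<lambda>\<Lambda>. \<Lambda> ** Y) ` L)"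
          using subspace_fitted subspace_imp_convex closed_subspace by blast+
        show "\<forall>z\<in>(\<lambda>\<Lambda>. \<Lambda> ** Y) ` L. dist Y (\<Lambda> ** Y) \<le> dist Y z"
          using \<Lambda> by (auto simp: least_squares_def residual_def dist_norm)
        show "\<forall>z\<in>(\<lambda>\<Lambda>. \<Lambda> ** Y) ` L. dist Y (N ** Y) \<le> dist Y z"
          using \<Lambda> norm by (auto simp: least_squares_def residual_def dist_norm)
      qed (use N(1) \<open>\<Lambda> \<in> L\<close> in auto)
      then have "(N - \<Lambda>) ** Y = 0"
        by (simp add: matrix_mult_diff_left)
      moreover have "N - \<Lambda> \<in> L"
        using N(1) \<open>\<Lambda> \<in> L\<close> subspace_diff[OF subspace_edge_matrices] by blast
      ultimately have "N = \<Lambda>"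
        using ker by force
      then show ?thesis
        by (simp add: \<Psi> \<omega>)
    qed
    then show "\<exists>!\<Psi>. is_MLE model Y \<Psi>"
      using least_squares_is_MLE[OF assms \<Lambda>] by blast
  qed
qed

end

theorem theoremA2:
  fixes E :: "('m::{finite,wellorder} \<times> 'm) set"
    and c :: "'m \<Rightarrow> 'm \<Rightarrow> 'c"
    and Y :: "real^'n^'m::{finite,wellorder}"
  assumes "ordered_dag E"
    and "compatible_colouring E c"
  shows "(unstable_under (coloured_matrices_SL E c) Y
           \<longleftrightarrow> \<not> bdd_above (log_likelihood Y ` rdag_model E c))
       \<and> (semistable_under (coloured_matrices_SL E c) Y
           \<longleftrightarrow> bdd_above (log_likelihood Y ` rdag_model E c))
       \<and> (polystable_under (coloured_matrices_SL E c) Y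
           \<longleftrightarrow> (\<exists>\<Psi>. is_MLE (rdag_model E c) Y \<Psi>))
       \<and> (stable_under (coloured_matrices_SL E c) Y
           \<longleftrightarrow> (\<exists>!\<Psi>. is_MLE (rdag_model E c) Y \<Psi>))"
proof -
  interpret sampled_rdag E c Y
    using assms by unfold_locales
  have "stable_under (coloured_matrices_SL E c) Y \<longleftrightarrow> (\<exists>!\<Psi>. is_MLE (rdag_model E c) Y \<Psi>)"
  proof (cases degenerate)
    case True
    then show ?thesis
      using MLE_exists_iff polystable_iff unfolding stable_under_def by blast
  next
    case False
    then show ?thesis
      unfolding stable_under_def finite_stabilizer_iff[OF False] MLE_unique_iff[OF False]
      by (simp add: polystable_iff)
  qed
  then show ?thesis
    unfolding semistable_under_def unstable_iff bdd_above_iff polystable_iff MLE_exists_iff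
    by simp
qed

end
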